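(* A simple group is icc if and only if it is infinite.
   Context: A group is icc if it is infinite and all of its conjugacy classes except $\{1\}$ are infinite. *)

theory Defs
  imports "HOL-Algebra.Coset"
begin

(* The locale simple_group of HOL-Algebra cannot be used here: it requires order G > 1, and
   order G, being card (carrier G), is 0 for infinite G, so it only covers finite groups.  This
   definition is the same except that non-triviality is stated as carrier G not being {1}. *)
definition is_simple :: "('a, 'b) monoid_scheme \<Rightarrow> bool" where
  "is_simple G \<longleftrightarrow>
     group G \<and> carrier G \<noteq> {\<one>\<^bsub>G\<^esub>} \<and>
     (\<forall>H. H \<lhd> G \<longrightarrow> H = carrier G \<or> H = {\<one>\<^bsub>G\<^esub>})"

definition conjugacy_class :: "('a, 'b) monoid_scheme \<Rightarrow> 'a \<Rightarrow> 'a set" where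
  "conjugacy_class G x = {g \<otimes>\<^bsub>G\<^esub> x \<otimes>\<^bsub>G\<^esub> inv\<^bsub>G\<^esub> g | g. g \<in> carrier G}"

definition conjugacy_classes :: "('a, 'b) monoid_scheme \<Rightarrow> 'a set set" where
  "conjugacy_classes G = conjugacy_class G ` carrier G"

definition icc :: "('a, 'b) monoid_scheme \<Rightarrow> bool" where
  "icc G \<longleftrightarrow>
     group G \<and> infinite (carrier G) \<and>
     (\<forall>C \<in> conjugacy_classes G - {{\<one>\<^bsub>G\<^esub>}}. infinite C)"

end

theory Submission
  imports Defs "HOL-Algebra.Multiplicative_Group"
begin

text \<open>An infinite simple group acts by conjugation on each conjugacy class \<open>C\<close>. If \<open>C\<close> is finite,
the kernel of this action cannot be trivial, so by simplicity it is the whole group and the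
elements of \<open>C\<close> are central. A central \<open>z \<noteq> \<one>\<close> generates a normal subgroup, hence the whole group,
which is then infinite cyclic; but then \<open>z\<^sup>2\<close> generates a proper nontrivial normal subgroup.\<close>

text \<open>When \<open>C\<close> is closed under conjugation, this is the kernel of the conjugation
  action of the group on \<open>C\<close>.\<close>

definition centralizer :: "('a, 'b) monoid_scheme \<Rightarrow> 'a set \<Rightarrow> 'a set" where
  "centralizer G C = {g \<in> carrier G. \<forall>c\<in>C. g \<otimes>\<^bsub>G\<^esub> c = c \<otimes>\<^bsub>G\<^esub> g}"

context group
begin

text \<open>After \<open>m_assoc\<close> has nested products to the right, an adjacent pair
  \<open>x\<close>, \<open>inv x\<close> may be followed by a further factor; in this form simp can
  still cancel it.\<close>

lemma cancel_left_inv: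
  assumes "x \<in> carrier G" "y \<in> carrier G"
  shows "x \<otimes> (inv x \<otimes> y) = y" "inv x \<otimes> (x \<otimes> y) = y"
  using assms by (simp_all flip: m_assoc)

lemma subgroup_centralizer:
  assumes C: "C \<subseteq> carrier G"
  shows "subgroup (centralizer G C) G"
proof (rule subgroupI)
  show "centralizer G C \<noteq> {}"
    using C by (auto simp: centralizer_def intro!: exI[of _ \<one>])
next
  fix a assume a: "a \<in> centralizer G C"
  have "inv a \<otimes> c = c \<otimes> inv a" if c: "c \<in> C" for c
  proof -
    have aG: "a \<in> carrier G" and ac: "a \<otimes> c = c \<otimes> a" and cG: "c \<in> carrier G"
      using a c C by (auto simp: centralizer_def)
    have "inv a \<otimes> c = inv a \<otimes> (c \<otimes> a) \<otimes> inv a"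
      using aG cG by (simp add: m_assoc)
    also have "\<dots> = inv a \<otimes> (a \<otimes> c) \<otimes> inv a"
      by (simp add: ac)
    also have "\<dots> = c \<otimes> inv a"
      using aG cG by (simp add: m_assoc cancel_left_inv)
    finally show ?thesis .
  qed
  with a show "inv a \<in> centralizer G C"
    by (simp add: centralizer_def)
next
  fix a b assume ab: "a \<in> centralizer G C" "b \<in> centralizer G C"
  have "a \<otimes> b \<otimes> c = c \<otimes> (a \<otimes> b)" if c: "c \<in> C" for c
  proof -
    have G: "a \<in> carrier G" "b \<in> carrier G" "c \<in> carrier G"
      and ac: "a \<otimes> c = c \<otimes> a" and bc: "b \<otimes> c = c \<otimes> b"
      using ab c C by (auto simp: centralizer_def)
    have "a \<otimes> b \<otimes> c = (a \<otimes> c) \<otimes> b"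
      using G bc by (simp add: m_assoc)
    then show ?thesis
      using G ac by (simp add: m_assoc)
  qed
  with ab show "a \<otimes> b \<in> centralizer G C"
    by (simp add: centralizer_def)
qed (auto simp: centralizer_def)

text \<open>Given \<open>c\<close> in \<open>C\<close>, closure under conjugation puts
  \<open>d = inv h \<otimes> c \<otimes> h\<close> in \<open>C\<close>, so \<open>g\<close> commutes
  with \<open>d\<close>. Conjugating that relation by \<open>h\<close> turns \<open>d\<close> back
  into \<open>c\<close> and \<open>g\<close> into its conjugate.\<close>

lemma normal_centralizer:
  assumes C: "C \<subseteq> carrier G"
    and conj: "\<And>g c. \<lbrakk>g \<in> carrier G; c \<in> C\<rbrakk> \<Longrightarrow> g \<otimes> c \<otimes> inv g \<in> C"
  shows "centralizer G C \<lhd> G"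
proof (rule normal_invI[OF subgroup_centralizer[OF C]])
  fix h g assume h: "h \<in> carrier G" and g: "g \<in> centralizer G C"
  then have gG: "g \<in> carrier G" by (simp add: centralizer_def)
  have "h \<otimes> g \<otimes> inv h \<otimes> c = c \<otimes> (h \<otimes> g \<otimes> inv h)" if c: "c \<in> C" for c
  proof -
    define d where "d = inv h \<otimes> c \<otimes> h"
    have cG: "c \<in> carrier G" and dG: "d \<in> carrier G"
      using c C h by (auto simp: d_def)
    have "d \<in> C"
      using conj[of "inv h" c] h c by (simp add: d_def)
    then have gd: "g \<otimes> d = d \<otimes> g"
      using g by (simp add: centralizer_def)
    have "h \<otimes> g \<otimes> inv h \<otimes> c = h \<otimes> (g \<otimes> d) \<otimes> inv h"
      using h gG cG by (simp add: d_def m_assoc)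
    also have "\<dots> = h \<otimes> (d \<otimes> g) \<otimes> inv h"
      by (simp add: gd)
    also have "\<dots> = c \<otimes> (h \<otimes> g \<otimes> inv h)"
      using h gG cG by (simp add: d_def m_assoc cancel_left_inv)
    finally show ?thesis .
  qed
  with h gG show "h \<otimes> g \<otimes> inv h \<in> centralizer G C"
    by (simp add: centralizer_def)
qed

text \<open>A trivial kernel makes the conjugation action faithful, so the group embeds into the
  self-maps of \<open>C\<close>, of which there are finitely many.\<close>

lemma finite_if_centralizer_trivial:
  assumes C: "C \<subseteq> carrier G" "finite C"
    and conj: "\<And>g c. \<lbrakk>g \<in> carrier G; c \<in> C\<rbrakk> \<Longrightarrow> g \<otimes> c \<otimes> inv g \<in> C"
    and triv: "centralizer G C = {\<one>}"
  shows "finite (carrier G)"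
proof (rule inj_on_finite)
  \<comment> \<open>Restricting the map to \<open>C\<close> makes it extensional, so that it lies in
    the finite set \<open>C \<rightarrow>\<^sub>E C\<close>.\<close>
  let ?act = "\<lambda>g. \<lambda>c\<in>C. g \<otimes> c \<otimes> inv g"
  show "inj_on ?act (carrier G)"
  proof (rule inj_onI)
    fix g h assume g: "g \<in> carrier G" and h: "h \<in> carrier G" and eq: "?act g = ?act h"
    have "inv h \<otimes> g \<otimes> c = c \<otimes> (inv h \<otimes> g)" if c: "c \<in> C" for c
    proof -
      have cG: "c \<in> carrier G" using c C by auto
      have "g \<otimes> c \<otimes> inv g = h \<otimes> c \<otimes> inv h"
        using fun_cong[OF eq, of c] c by simp
      \<comment> \<open>The outer factors \<open>inv h\<close> and \<open>g\<close> turn equality of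
        the two conjugates of \<open>c\<close> into commutation of \<open>inv h \<otimes> g\<close>
        with \<open>c\<close>.\<close>
      then have "inv h \<otimes> (g \<otimes> c \<otimes> inv g) \<otimes> g = inv h \<otimes> (h \<otimes> c \<otimes> inv h) \<otimes> g"
        by simp
      moreover have "inv h \<otimes> (g \<otimes> c \<otimes> inv g) \<otimes> g = inv h \<otimes> g \<otimes> c"
        using g h cG by (simp add: m_assoc)
      moreover have "inv h \<otimes> (h \<otimes> c \<otimes> inv h) \<otimes> g = c \<otimes> (inv h \<otimes> g)"
        using g h cG by (simp add: m_assoc cancel_left_inv)
      ultimately show ?thesis by simp
    qed
    then have "inv h \<otimes> g \<in> centralizer G C"
      using g h by (simp add: centralizer_def)
    then have "inv h \<otimes> g = \<one>"
      using triv by simp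
    then show "g = h"
      using g h by (metis inv_closed inv_equality inv_inv)
  qed
  show "?act ` carrier G \<subseteq> (C \<rightarrow>\<^sub>E C)"
    using conj by auto
  show "finite (C \<rightarrow>\<^sub>E C)"
    using C by (simp add: finite_PiE)
qed

text \<open>Successive conjugations by \<open>h\<close> and \<open>g\<close> amount to one by
  \<open>g \<otimes> h\<close>. This supplies the closure hypothesis on \<open>C\<close> used
  above.\<close>

lemma conjugate_in_conjugacy_class:
  assumes "x \<in> carrier G" "g \<in> carrier G" "c \<in> conjugacy_class G x"
  shows "g \<otimes> c \<otimes> inv g \<in> conjugacy_class G x"
proof -
  obtain h where h: "h \<in> carrier G" "c = h \<otimes> x \<otimes> inv h"
    using assms by (auto simp: conjugacy_class_def)
  then have "g \<otimes> c \<otimes> inv g = (g \<otimes> h) \<otimes> x \<otimes> inv (g \<otimes> h)"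
    using assms by (simp add: m_assoc inv_mult_group)
  with h assms show ?thesis
    unfolding conjugacy_class_def by blast
qed

text \<open>Closure under conjugation need only be checked on the generator, which conjugation
  fixes.\<close>

lemma central_generate_normal:
  assumes z: "z \<in> carrier G" and "\<And>g. g \<in> carrier G \<Longrightarrow> g \<otimes> z = z \<otimes> g"
  shows "generate G {z} \<lhd> G"
  by (rule normal_generateI) (use assms in \<open>auto simp: m_assoc\<close>)

lemma infinite_simple_center_trivial:
  assumes inf: "infinite (carrier G)"
    and simple: "\<And>H. H \<lhd> G \<Longrightarrow> H = carrier G \<or> H = {\<one>}"
    and z: "z \<in> carrier G" and comm: "\<And>g. g \<in> carrier G \<Longrightarrow> g \<otimes> z = z \<otimes> g"
  shows "z = \<one>"
proof (rule ccontr)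
  assume "z \<noteq> \<one>"
  \<comment> \<open>Stated for any central \<open>y\<close>, since it is applied both to
    \<open>z\<close> and to its square.\<close>
  have gen: "generate G {y} = carrier G"
    if "y \<in> carrier G" "y \<noteq> \<one>" "\<And>g. g \<in> carrier G \<Longrightarrow> g \<otimes> y = y \<otimes> g" for y
    using simple[OF central_generate_normal[of y]] that generate.incl[of y "{y}" G] by auto
  have "infinite (generate G {z})"
    using gen[OF z \<open>z \<noteq> \<one>\<close> comm] inf by simp
  \<comment> \<open>Order 0 encodes infinite order, because \<open>card\<close> of an infinite set
    is 0.\<close>
  then have ord: "ord z = 0"
    using generate_pow_card[OF z] by simp
  let ?w = "z [^] (2::int)"
  have w: "?w = z \<otimes> z"
    using int_pow_mult[OF z, of 1 1] z by simp
  have "?w \<noteq> \<one>"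
    using int_pow_eq_id[OF z, of 2] ord by simp
  moreover have "g \<otimes> ?w = ?w \<otimes> g" if "g \<in> carrier G" for g
    using comm[OF that] that z unfolding w by (metis m_assoc)
  ultimately have "generate G {?w} = carrier G"
    using gen z by simp
  then obtain k :: int where "z = ?w [^] k"
    using generate_pow[of ?w] z by auto
  then have "z [^] (1::int) = z [^] (2 * k)"
    using z by (simp add: int_pow_pow)
  \<comment> \<open>Exponents giving the same power agree modulo \<open>ord z\<close>; modulo 0 this
    means that they are equal.\<close>
  then have "2 * k = 1"
    using int_pow_eq[OF z, of 1 "2 * k"] ord by simp
  then show False by presburger
qed

end

theorem proposition0p1:
  fixes G :: "('a, 'b) monoid_scheme"
  assumes "is_simple G"
  shows "icc G \<longleftrightarrow> infinite (carrier G)"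
proof
  assume inf: "infinite (carrier G)"
  interpret group G
    using assms by (simp add: is_simple_def)
  have simple: "H = carrier G \<or> H = {\<one>\<^bsub>G\<^esub>}" if "H \<lhd> G" for H
    using assms that by (simp add: is_simple_def)
  \<comment> \<open>This is the contrapositive of the icc condition: a finite class must be the
    trivial one.\<close>
  have "conjugacy_class G x = {\<one>\<^bsub>G\<^esub>}"
    if x: "x \<in> carrier G" and fin: "finite (conjugacy_class G x)" for x
  proof -
    let ?C = "conjugacy_class G x"
    have C: "?C \<subseteq> carrier G"
      using x by (auto simp: conjugacy_class_def)
    note conj = conjugate_in_conjugacy_class[OF x]
    have "centralizer G ?C \<noteq> {\<one>\<^bsub>G\<^esub>}"
      using finite_if_centralizer_trivial[OF C fin conj] inf by blast
    then have central: "centralizer G ?C = carrier G"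
      using simple[OF normal_centralizer[OF C conj]] by blast
    \<comment> \<open>Every group element centralizes the class, so each \<open>c\<close> in it is
      central.\<close>
    have "c = \<one>\<^bsub>G\<^esub>" if "c \<in> ?C" for c
      by (rule infinite_simple_center_trivial[OF inf simple])
        (use that C central in \<open>auto simp: centralizer_def\<close>)
    moreover have "?C \<noteq> {}"
      by (auto simp: conjugacy_class_def)
    ultimately show ?thesis by blast
  qed
  then show "icc G"
    using inf is_group by (auto simp: icc_def conjugacy_classes_def)
qed (simp add: icc_def)

end
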